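(* Let $\mathcal C$ be a $\mathbf{gr}$-category and suppose $S:\mathcal C\to\mathcal C$ is a right Serre $\mathbf{gr}$-functor. Then $N_*(S):N_*(\mathcal C)\to N_*(\mathcal C)$ is a right Serre $\Bbbk$-functor.
   Context: $\Bbbk$ is a commutative ring with unity. $\mathbf{gr}$ is the closed symmetric monoidal category of $\mathbb Z$-graded $\Bbbk$-modules, with unit $\Bbbk$ (in degree 0), signed symmetry $x\otimes y\mapsto(-1)^{\deg x\deg y}y\otimes x$, and inner hom $\underline{\mathbf{gr}}(X,Y)^n=\prod_d\mathrm{Hom}_{\Bbbk}(X^d,Y^{d+n})$. The functor $N:\mathbf{gr}\to\Bbbk\text{-Mod}$, $X=(X^n)_{n\in\mathbb Z}\mapsto X^0$, is lax symmetric monoidal via the natural embeddings $X^0\otimes Y^0\hookrightarrow(X\otimes Y)^0$; $N_*$ is the induced base change: $N_*(\mathcal C)$ is the $\Bbbk$-linear category with the objects of $\mathcal C$ and morphisms $\mathcal C(X,Y)^0$. For a closed symmetric monoidal category $\mathcal V$ with unit $\mathbf 1$ and inner hom $\underline{\mathcal V}$, a right Serre functor of a $\mathcal V$-category $\mathcal C$ is a $\mathcal V$-functor $S:\mathcal C\to\mathcal C$ (written $Y\mapsto YS$) for which there are isomorphisms $\psi_{X,Y}:\mathcal C(X,YS)\to\underline{\mathcal V}(\mathcal C(Y,X),\mathbf 1)$ in $\mathcal V$, $\mathcal V$-natural in $X$ and $Y$. Right Serre $\Bbbk$-functors are those for $\mathcal V=\Bbbk\text{-Mod}$. *)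

theory Defs
  imports "HOL-Algebra.Module"
begin

text \<open>
  Conventions.  Morphisms and maps compose from left to right: composition is
  a morphism \<open>C(X,Y) \<otimes> C(Y,Z) \<rightarrow> C(X,Z)\<close>, and evaluation is
  \<open>M \<otimes> gr(M,N) \<rightarrow> N\<close>.  A morphism out of a tensor product is given by the
  corresponding family of bilinear maps.  All Koszul signs below come from the symmetry
  \<open>x \<otimes> y \<mapsto> (-1)\<^sup>m\<^sup>n y \<otimes> x\<close> (\<open>x\<close>, \<open>y\<close> of degrees \<open>m\<close>, \<open>n\<close>).

  A graded module is a family \<open>int \<Rightarrow> ('k, 'm) module\<close> of modules.  Elements do not remember
  their degree, so operations on homogeneous elements take the degrees as arguments.  The
  ring multiplication and unit that the record type \<^typ>\<open>('k, 'm) module\<close> inherits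
  are irrelevant for modules and are left undefined.
\<close>


section \<open>Modules and \<open>\<bbbk>\<close>-linear categories\<close>

definition unit_mod :: "('k, 'r) ring_scheme \<Rightarrow> ('k, 'k) module" where
  "unit_mod R = \<lparr>carrier = carrier R, mult = undefined, one = undefined,
     zero = \<zero>\<^bsub>R\<^esub>, add = add R, smult = mult R\<rparr>"

definition zero_mod :: "('k, 'r) ring_scheme \<Rightarrow> ('k, 'k) module" where
  "zero_mod R = \<lparr>carrier = {\<zero>\<^bsub>R\<^esub>}, mult = undefined, one = undefined,
     zero = \<zero>\<^bsub>R\<^esub>, add = add R, smult = mult R\<rparr>"

text \<open>Linear maps are taken extensional, so that equal maps are equal as HOL functions.\<close>

definition lin_hom ::
  "('k, 'r) ring_scheme \<Rightarrow> ('k, 'a) module \<Rightarrow> ('k, 'b) module \<Rightarrow> ('k, 'a \<Rightarrow> 'b) module" where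
  "lin_hom R M N = \<lparr>
     carrier = {f \<in> carrier M \<rightarrow>\<^sub>E carrier N.
        (\<forall>x\<in>carrier M. \<forall>y\<in>carrier M. f (x \<oplus>\<^bsub>M\<^esub> y) = f x \<oplus>\<^bsub>N\<^esub> f y) \<and>
        (\<forall>r\<in>carrier R. \<forall>x\<in>carrier M. f (r \<odot>\<^bsub>M\<^esub> x) = r \<odot>\<^bsub>N\<^esub> f x)},
     mult = undefined, one = undefined,
     zero = (\<lambda>x\<in>carrier M. \<zero>\<^bsub>N\<^esub>),
     add = (\<lambda>f g. \<lambda>x\<in>carrier M. f x \<oplus>\<^bsub>N\<^esub> g x),
     smult = (\<lambda>r f. \<lambda>x\<in>carrier M. r \<odot>\<^bsub>N\<^esub> f x)\<rparr>"

definition lin_comp :: "('k, 'a) module \<Rightarrow> ('a \<Rightarrow> 'b) \<Rightarrow> ('b \<Rightarrow> 'c) \<Rightarrow> 'a \<Rightarrow> 'c" where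
  "lin_comp M f g = (\<lambda>x\<in>carrier M. g (f x))"

definition lin_iso ::
  "('k, 'r) ring_scheme \<Rightarrow> ('k, 'a) module \<Rightarrow> ('k, 'b) module \<Rightarrow> ('a \<Rightarrow> 'b) \<Rightarrow> bool" where
  "lin_iso R M N p \<longleftrightarrow>
     p \<in> carrier (lin_hom R M N) \<and> bij_betw p (carrier M) (carrier N)"

record ('o, 'm, 'k) lin_cat =
  lObj :: "'o set"
  lHom :: "'o \<Rightarrow> 'o \<Rightarrow> ('k, 'm) module"
  lComp :: "'o \<Rightarrow> 'o \<Rightarrow> 'o \<Rightarrow> 'm \<Rightarrow> 'm \<Rightarrow> 'm"
  lId :: "'o \<Rightarrow> 'm"

locale lin_category = cring R for R (structure) and C :: "('o, 'm, 'k) lin_cat" +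
  assumes hom_module:
      "\<lbrakk>X \<in> lObj C; Y \<in> lObj C\<rbrakk> \<Longrightarrow> module R (lHom C X Y)"
    and comp_closed:
      "\<lbrakk>X \<in> lObj C; Y \<in> lObj C; Z \<in> lObj C;
        f \<in> carrier (lHom C X Y); g \<in> carrier (lHom C Y Z)\<rbrakk>
       \<Longrightarrow> lComp C X Y Z f g \<in> carrier (lHom C X Z)"
    and comp_add_left:
      "\<lbrakk>X \<in> lObj C; Y \<in> lObj C; Z \<in> lObj C;
        f \<in> carrier (lHom C X Y); f' \<in> carrier (lHom C X Y); g \<in> carrier (lHom C Y Z)\<rbrakk>
       \<Longrightarrow> lComp C X Y Z (f \<oplus>\<^bsub>lHom C X Y\<^esub> f') g =
           lComp C X Y Z f g \<oplus>\<^bsub>lHom C X Z\<^esub> lComp C X Y Z f' g"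
    and comp_add_right:
      "\<lbrakk>X \<in> lObj C; Y \<in> lObj C; Z \<in> lObj C;
        f \<in> carrier (lHom C X Y); g \<in> carrier (lHom C Y Z); g' \<in> carrier (lHom C Y Z)\<rbrakk>
       \<Longrightarrow> lComp C X Y Z f (g \<oplus>\<^bsub>lHom C Y Z\<^esub> g') =
           lComp C X Y Z f g \<oplus>\<^bsub>lHom C X Z\<^esub> lComp C X Y Z f g'"
    and comp_smult_left:
      "\<lbrakk>X \<in> lObj C; Y \<in> lObj C; Z \<in> lObj C; r \<in> carrier R;
        f \<in> carrier (lHom C X Y); g \<in> carrier (lHom C Y Z)\<rbrakk>
       \<Longrightarrow> lComp C X Y Z (r \<odot>\<^bsub>lHom C X Y\<^esub> f) g = r \<odot>\<^bsub>lHom C X Z\<^esub> lComp C X Y Z f g"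
    and comp_smult_right:
      "\<lbrakk>X \<in> lObj C; Y \<in> lObj C; Z \<in> lObj C; r \<in> carrier R;
        f \<in> carrier (lHom C X Y); g \<in> carrier (lHom C Y Z)\<rbrakk>
       \<Longrightarrow> lComp C X Y Z f (r \<odot>\<^bsub>lHom C Y Z\<^esub> g) = r \<odot>\<^bsub>lHom C X Z\<^esub> lComp C X Y Z f g"
    and id_closed:
      "X \<in> lObj C \<Longrightarrow> lId C X \<in> carrier (lHom C X X)"
    and comp_id_left:
      "\<lbrakk>X \<in> lObj C; Y \<in> lObj C; f \<in> carrier (lHom C X Y)\<rbrakk>
       \<Longrightarrow> lComp C X X Y (lId C X) f = f"
    and comp_id_right:
      "\<lbrakk>X \<in> lObj C; Y \<in> lObj C; f \<in> carrier (lHom C X Y)\<rbrakk>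
       \<Longrightarrow> lComp C X Y Y f (lId C Y) = f"
    and comp_assoc:
      "\<lbrakk>W \<in> lObj C; X \<in> lObj C; Y \<in> lObj C; Z \<in> lObj C;
        f \<in> carrier (lHom C W X); g \<in> carrier (lHom C X Y); h \<in> carrier (lHom C Y Z)\<rbrakk>
       \<Longrightarrow> lComp C W Y Z (lComp C W X Y f g) h = lComp C W X Z f (lComp C X Y Z g h)"

record ('o, 'm, 'p, 'n) lin_fun =
  lfObj :: "'o \<Rightarrow> 'p"
  lfMap :: "'o \<Rightarrow> 'o \<Rightarrow> 'm \<Rightarrow> 'n"

locale lin_functor = source: lin_category R C + target: lin_category R D
  for R (structure) and C :: "('o, 'm, 'k) lin_cat" and D :: "('p, 'n, 'k) lin_cat" +
  fixes F :: "('o, 'm, 'p, 'n) lin_fun"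
  assumes obj_closed:
      "X \<in> lObj C \<Longrightarrow> lfObj F X \<in> lObj D"
    and map_closed:
      "\<lbrakk>X \<in> lObj C; Y \<in> lObj C; f \<in> carrier (lHom C X Y)\<rbrakk>
       \<Longrightarrow> lfMap F X Y f \<in> carrier (lHom D (lfObj F X) (lfObj F Y))"
    and map_add:
      "\<lbrakk>X \<in> lObj C; Y \<in> lObj C; f \<in> carrier (lHom C X Y); g \<in> carrier (lHom C X Y)\<rbrakk>
       \<Longrightarrow> lfMap F X Y (f \<oplus>\<^bsub>lHom C X Y\<^esub> g) =
           lfMap F X Y f \<oplus>\<^bsub>lHom D (lfObj F X) (lfObj F Y)\<^esub> lfMap F X Y g"
    and map_smult:
      "\<lbrakk>X \<in> lObj C; Y \<in> lObj C; r \<in> carrier R; f \<in> carrier (lHom C X Y)\<rbrakk>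
       \<Longrightarrow> lfMap F X Y (r \<odot>\<^bsub>lHom C X Y\<^esub> f) =
           r \<odot>\<^bsub>lHom D (lfObj F X) (lfObj F Y)\<^esub> lfMap F X Y f"
    and map_id:
      "X \<in> lObj C \<Longrightarrow> lfMap F X X (lId C X) = lId D (lfObj F X)"
    and map_comp:
      "\<lbrakk>X \<in> lObj C; Y \<in> lObj C; Z \<in> lObj C;
        f \<in> carrier (lHom C X Y); g \<in> carrier (lHom C Y Z)\<rbrakk>
       \<Longrightarrow> lfMap F X Z (lComp C X Y Z f g) =
           lComp D (lfObj F X) (lfObj F Y) (lfObj F Z) (lfMap F X Y f) (lfMap F Y Z g)"

definition lin_op :: "('o, 'm, 'k) lin_cat \<Rightarrow> ('o, 'm, 'k) lin_cat" where
  "lin_op C = \<lparr>lObj = lObj C, lHom = (\<lambda>X Y. lHom C Y X),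
     lComp = (\<lambda>X Y Z f g. lComp C Z Y X g f), lId = lId C\<rparr>"

definition lin_fun_op :: "('o, 'm, 'p, 'n) lin_fun \<Rightarrow> ('o, 'm, 'p, 'n) lin_fun" where
  "lin_fun_op F = \<lparr>lfObj = lfObj F, lfMap = (\<lambda>X Y. lfMap F Y X)\<rparr>"

text \<open>\<open>lin_fun_comp F G\<close> is first \<open>F\<close>, then \<open>G\<close>.\<close>

definition lin_fun_comp ::
  "('o, 'm, 'p, 'n) lin_fun \<Rightarrow> ('p, 'n, 'q, 'l) lin_fun \<Rightarrow> ('o, 'm, 'q, 'l) lin_fun" where
  "lin_fun_comp F G = \<lparr>lfObj = (\<lambda>X. lfObj G (lfObj F X)),
     lfMap = (\<lambda>X Y f. lfMap G (lfObj F X) (lfObj F Y) (lfMap F X Y f))\<rparr>"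

text \<open>
  The functor \<open>C(X,-) : C \<rightarrow> \<bbbk>-Mod\<close>.  The contravariant functor \<open>C(-,Z)\<close> is
  obtained by applying it to the opposite category.
\<close>

definition lin_hom_fun ::
  "('o, 'm, 'k) lin_cat \<Rightarrow> 'o \<Rightarrow> ('o, 'm, ('k, 'm) module, 'm \<Rightarrow> 'm) lin_fun" where
  "lin_hom_fun C X = \<lparr>lfObj = (\<lambda>Y. lHom C X Y),
     lfMap = (\<lambda>Y Z g. \<lambda>h\<in>carrier (lHom C X Y). lComp C X Y Z h g)\<rparr>"

text \<open>
  The functor \<open>Hom(-,\<bbbk>) : \<bbbk>-Mod\<^sup>o\<^sup>p \<rightarrow> \<bbbk>-Mod\<close>; a morphism \<open>M \<rightarrow> N\<close> of
  \<open>\<bbbk>-Mod\<^sup>o\<^sup>p\<close> is a linear map \<open>f : N \<rightarrow> M\<close>.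
\<close>

definition lin_dual :: "('k, 'r) ring_scheme \<Rightarrow>
    (('k, 'm) module, 'm \<Rightarrow> 'm, ('k, 'm \<Rightarrow> 'k) module, ('m \<Rightarrow> 'k) \<Rightarrow> ('m \<Rightarrow> 'k)) lin_fun" where
  "lin_dual R = \<lparr>lfObj = (\<lambda>M. lin_hom R M (unit_mod R)),
     lfMap = (\<lambda>M N f. \<lambda>p\<in>carrier (lin_hom R M (unit_mod R)). lin_comp N f p)\<rparr>"

text \<open>
  Naturality of a family \<open>\<psi>\<close> between functors \<open>F\<close>, \<open>G\<close> from \<open>C\<close> to
  \<open>\<bbbk>\<close>-modules; their values may have different element types.
\<close>

definition lin_natural :: "('k, 'r) ring_scheme \<Rightarrow> ('o, 'm, 'k) lin_cat \<Rightarrow>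
    ('o, 'm, ('k, 'a) module, 'a \<Rightarrow> 'a) lin_fun \<Rightarrow>
    ('o, 'm, ('k, 'b) module, 'b \<Rightarrow> 'b) lin_fun \<Rightarrow> ('o \<Rightarrow> 'a \<Rightarrow> 'b) \<Rightarrow> bool" where
  "lin_natural R C F G \<psi> \<longleftrightarrow>
     (\<forall>X\<in>lObj C. \<psi> X \<in> carrier (lin_hom R (lfObj F X) (lfObj G X))) \<and>
     (\<forall>X\<in>lObj C. \<forall>Y\<in>lObj C. \<forall>f\<in>carrier (lHom C X Y).
        lin_comp (lfObj F X) (lfMap F X Y f) (\<psi> Y) =
        lin_comp (lfObj F X) (\<psi> X) (lfMap G X Y f))"

definition right_Serre_lin_functor ::
  "('k, 'r) ring_scheme \<Rightarrow> ('o, 'm, 'k) lin_cat \<Rightarrow> ('o, 'm, 'o, 'm) lin_fun \<Rightarrow> bool" where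
  "right_Serre_lin_functor R C S \<longleftrightarrow>
     lin_functor R C C S \<and>
     (\<exists>\<psi>.
        (\<forall>X\<in>lObj C. \<forall>Y\<in>lObj C.
           lin_iso R (lHom C X (lfObj S Y)) (lin_hom R (lHom C Y X) (unit_mod R)) (\<psi> X Y)) \<and>
        (\<forall>Y\<in>lObj C.
           lin_natural R (lin_op C)
             (lin_hom_fun (lin_op C) (lfObj S Y))
             (lin_fun_comp (lin_fun_op (lin_hom_fun C Y)) (lin_dual R))
             (\<lambda>X. \<psi> X Y)) \<and>
        (\<forall>X\<in>lObj C.
           lin_natural R C
             (lin_fun_comp S (lin_hom_fun C X))
             (lin_fun_comp (lin_fun_op (lin_hom_fun (lin_op C) X)) (lin_dual R))
             (\<lambda>Y. \<psi> X Y)))"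


section \<open>Graded modules and \<open>gr\<close>-categories\<close>

definition gr_unit :: "('k, 'r) ring_scheme \<Rightarrow> int \<Rightarrow> ('k, 'k) module" where
  "gr_unit R n = (if n = 0 then unit_mod R else zero_mod R)"

text \<open>The inner hom \<open>gr(M,N)\<^sup>n = \<Prod>\<^sub>d Hom(M\<^sup>d, N\<^sup>d\<^sup>+\<^sup>n)\<close>, with the product module structure.\<close>

definition gr_hom :: "('k, 'r) ring_scheme \<Rightarrow> (int \<Rightarrow> ('k, 'a) module) \<Rightarrow>
    (int \<Rightarrow> ('k, 'b) module) \<Rightarrow> int \<Rightarrow> ('k, int \<Rightarrow> 'a \<Rightarrow> 'b) module" where
  "gr_hom R M N n = \<lparr>
     carrier = {f. \<forall>d. f d \<in> carrier (lin_hom R (M d) (N (d + n)))},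
     mult = undefined, one = undefined,
     zero = (\<lambda>d. \<zero>\<^bsub>lin_hom R (M d) (N (d + n))\<^esub>),
     add = (\<lambda>f g d. f d \<oplus>\<^bsub>lin_hom R (M d) (N (d + n))\<^esub> g d),
     smult = (\<lambda>r f d. r \<odot>\<^bsub>lin_hom R (M d) (N (d + n))\<^esub> f d)\<rparr>"

text \<open>
  Composition of \<open>f \<in> gr(M,N)\<^sup>m\<close> and \<open>g \<in> gr(N,P)\<^sup>n\<close>.  No sign occurs, since
  maps act from the right: \<open>x(fg) = (xf)g\<close>.
\<close>

definition gr_comp :: "(int \<Rightarrow> ('k, 'a) module) \<Rightarrow> int \<Rightarrow>
    (int \<Rightarrow> 'a \<Rightarrow> 'b) \<Rightarrow> (int \<Rightarrow> 'b \<Rightarrow> 'c) \<Rightarrow> int \<Rightarrow> 'a \<Rightarrow> 'c" where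
  "gr_comp M m f g = (\<lambda>d. lin_comp (M d) (f d) (g (d + m)))"

definition gr_iso :: "('k, 'r) ring_scheme \<Rightarrow> (int \<Rightarrow> ('k, 'a) module) \<Rightarrow>
    (int \<Rightarrow> ('k, 'b) module) \<Rightarrow> (int \<Rightarrow> 'a \<Rightarrow> 'b) \<Rightarrow> bool" where
  "gr_iso R M N p \<longleftrightarrow>
     p \<in> carrier (gr_hom R M N 0) \<and> (\<forall>d. bij_betw (p d) (carrier (M d)) (carrier (N d)))"

text \<open>\<open>koszul M m n x\<close> is \<open>(-1)\<^sup>m\<^sup>n x\<close>, for an element \<open>x\<close> of the module \<open>M\<close>.\<close>

definition koszul :: "('k, 'm) module \<Rightarrow> int \<Rightarrow> int \<Rightarrow> 'm \<Rightarrow> 'm" where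
  "koszul M m n x = (if odd (m * n) then \<ominus>\<^bsub>M\<^esub> x else x)"

record ('o, 'm, 'k) gr_cat =
  gObj :: "'o set"
  gHom :: "'o \<Rightarrow> 'o \<Rightarrow> int \<Rightarrow> ('k, 'm) module"
  gComp :: "'o \<Rightarrow> 'o \<Rightarrow> 'o \<Rightarrow> int \<Rightarrow> int \<Rightarrow> 'm \<Rightarrow> 'm \<Rightarrow> 'm"
  gId :: "'o \<Rightarrow> 'm"

locale gr_category = cring R for R (structure) and C :: "('o, 'm, 'k) gr_cat" +
  assumes hom_module:
      "\<lbrakk>X \<in> gObj C; Y \<in> gObj C\<rbrakk> \<Longrightarrow> module R (gHom C X Y n)"
    and comp_closed:
      "\<lbrakk>X \<in> gObj C; Y \<in> gObj C; Z \<in> gObj C;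
        f \<in> carrier (gHom C X Y m); g \<in> carrier (gHom C Y Z n)\<rbrakk>
       \<Longrightarrow> gComp C X Y Z m n f g \<in> carrier (gHom C X Z (m + n))"
    and comp_add_left:
      "\<lbrakk>X \<in> gObj C; Y \<in> gObj C; Z \<in> gObj C;
        f \<in> carrier (gHom C X Y m); f' \<in> carrier (gHom C X Y m); g \<in> carrier (gHom C Y Z n)\<rbrakk>
       \<Longrightarrow> gComp C X Y Z m n (f \<oplus>\<^bsub>gHom C X Y m\<^esub> f') g =
           gComp C X Y Z m n f g \<oplus>\<^bsub>gHom C X Z (m + n)\<^esub> gComp C X Y Z m n f' g"
    and comp_add_right:
      "\<lbrakk>X \<in> gObj C; Y \<in> gObj C; Z \<in> gObj C;
        f \<in> carrier (gHom C X Y m); g \<in> carrier (gHom C Y Z n); g' \<in> carrier (gHom C Y Z n)\<rbrakk>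
       \<Longrightarrow> gComp C X Y Z m n f (g \<oplus>\<^bsub>gHom C Y Z n\<^esub> g') =
           gComp C X Y Z m n f g \<oplus>\<^bsub>gHom C X Z (m + n)\<^esub> gComp C X Y Z m n f g'"
    and comp_smult_left:
      "\<lbrakk>X \<in> gObj C; Y \<in> gObj C; Z \<in> gObj C; r \<in> carrier R;
        f \<in> carrier (gHom C X Y m); g \<in> carrier (gHom C Y Z n)\<rbrakk>
       \<Longrightarrow> gComp C X Y Z m n (r \<odot>\<^bsub>gHom C X Y m\<^esub> f) g =
           r \<odot>\<^bsub>gHom C X Z (m + n)\<^esub> gComp C X Y Z m n f g"
    and comp_smult_right:
      "\<lbrakk>X \<in> gObj C; Y \<in> gObj C; Z \<in> gObj C; r \<in> carrier R;
        f \<in> carrier (gHom C X Y m); g \<in> carrier (gHom C Y Z n)\<rbrakk>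
       \<Longrightarrow> gComp C X Y Z m n f (r \<odot>\<^bsub>gHom C Y Z n\<^esub> g) =
           r \<odot>\<^bsub>gHom C X Z (m + n)\<^esub> gComp C X Y Z m n f g"
    and id_closed:
      "X \<in> gObj C \<Longrightarrow> gId C X \<in> carrier (gHom C X X 0)"
    and comp_id_left:
      "\<lbrakk>X \<in> gObj C; Y \<in> gObj C; f \<in> carrier (gHom C X Y n)\<rbrakk>
       \<Longrightarrow> gComp C X X Y 0 n (gId C X) f = f"
    and comp_id_right:
      "\<lbrakk>X \<in> gObj C; Y \<in> gObj C; f \<in> carrier (gHom C X Y n)\<rbrakk>
       \<Longrightarrow> gComp C X Y Y n 0 f (gId C Y) = f"
    and comp_assoc:
      "\<lbrakk>W \<in> gObj C; X \<in> gObj C; Y \<in> gObj C; Z \<in> gObj C;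
        f \<in> carrier (gHom C W X l); g \<in> carrier (gHom C X Y m); h \<in> carrier (gHom C Y Z n)\<rbrakk>
       \<Longrightarrow> gComp C W Y Z (l + m) n (gComp C W X Y l m f g) h =
           gComp C W X Z l (m + n) f (gComp C X Y Z m n g h)"

record ('o, 'm, 'p, 'n) gr_fun =
  gfObj :: "'o \<Rightarrow> 'p"
  gfMap :: "'o \<Rightarrow> 'o \<Rightarrow> int \<Rightarrow> 'm \<Rightarrow> 'n"

locale gr_functor = source: gr_category R C + target: gr_category R D
  for R (structure) and C :: "('o, 'm, 'k) gr_cat" and D :: "('p, 'n, 'k) gr_cat" +
  fixes F :: "('o, 'm, 'p, 'n) gr_fun"
  assumes obj_closed:
      "X \<in> gObj C \<Longrightarrow> gfObj F X \<in> gObj D"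
    and map_closed:
      "\<lbrakk>X \<in> gObj C; Y \<in> gObj C; f \<in> carrier (gHom C X Y n)\<rbrakk>
       \<Longrightarrow> gfMap F X Y n f \<in> carrier (gHom D (gfObj F X) (gfObj F Y) n)"
    and map_add:
      "\<lbrakk>X \<in> gObj C; Y \<in> gObj C; f \<in> carrier (gHom C X Y n); g \<in> carrier (gHom C X Y n)\<rbrakk>
       \<Longrightarrow> gfMap F X Y n (f \<oplus>\<^bsub>gHom C X Y n\<^esub> g) =
           gfMap F X Y n f \<oplus>\<^bsub>gHom D (gfObj F X) (gfObj F Y) n\<^esub> gfMap F X Y n g"
    and map_smult:
      "\<lbrakk>X \<in> gObj C; Y \<in> gObj C; r \<in> carrier R; f \<in> carrier (gHom C X Y n)\<rbrakk>
       \<Longrightarrow> gfMap F X Y n (r \<odot>\<^bsub>gHom C X Y n\<^esub> f) =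
           r \<odot>\<^bsub>gHom D (gfObj F X) (gfObj F Y) n\<^esub> gfMap F X Y n f"
    and map_id:
      "X \<in> gObj C \<Longrightarrow> gfMap F X X 0 (gId C X) = gId D (gfObj F X)"
    and map_comp:
      "\<lbrakk>X \<in> gObj C; Y \<in> gObj C; Z \<in> gObj C;
        f \<in> carrier (gHom C X Y m); g \<in> carrier (gHom C Y Z n)\<rbrakk>
       \<Longrightarrow> gfMap F X Z (m + n) (gComp C X Y Z m n f g) =
           gComp D (gfObj F X) (gfObj F Y) (gfObj F Z) m n (gfMap F X Y m f) (gfMap F Y Z n g)"

text \<open>
  Composition in the opposite category involves the symmetry: for \<open>f \<in> C(Y,X)\<^sup>m\<close>
  and \<open>g \<in> C(Z,Y)\<^sup>n\<close> it sends \<open>f \<otimes> g\<close> to \<open>(-1)\<^sup>m\<^sup>n gf\<close>.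
\<close>

definition gr_op :: "('o, 'm, 'k) gr_cat \<Rightarrow> ('o, 'm, 'k) gr_cat" where
  "gr_op C = \<lparr>gObj = gObj C, gHom = (\<lambda>X Y. gHom C Y X),
     gComp = (\<lambda>X Y Z m n f g. koszul (gHom C Z X (m + n)) m n (gComp C Z Y X n m g f)),
     gId = gId C\<rparr>"

definition gr_fun_op :: "('o, 'm, 'p, 'n) gr_fun \<Rightarrow> ('o, 'm, 'p, 'n) gr_fun" where
  "gr_fun_op F = \<lparr>gfObj = gfObj F, gfMap = (\<lambda>X Y. gfMap F Y X)\<rparr>"

definition gr_fun_comp ::
  "('o, 'm, 'p, 'n) gr_fun \<Rightarrow> ('p, 'n, 'q, 'l) gr_fun \<Rightarrow> ('o, 'm, 'q, 'l) gr_fun" where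
  "gr_fun_comp F G = \<lparr>gfObj = (\<lambda>X. gfObj G (gfObj F X)),
     gfMap = (\<lambda>X Y n f. gfMap G (gfObj F X) (gfObj F Y) n (gfMap F X Y n f))\<rparr>"

text \<open>
  The functor \<open>C(X,-) : C \<rightarrow> gr\<close>, whose action \<open>C(Y,Z) \<rightarrow> gr(C(X,Y), C(X,Z))\<close>
  is adjoint to composition.  As before, \<open>C(-,Z)\<close> is obtained from the opposite category,
  where it carries the sign \<open>h \<mapsto> (-1)\<^sup>d\<^sup>n fh\<close> for \<open>f\<close>, \<open>h\<close> of degrees \<open>n\<close>, \<open>d\<close>.
\<close>

definition gr_hom_fun :: "('o, 'm, 'k) gr_cat \<Rightarrow> 'o \<Rightarrow>
    ('o, 'm, int \<Rightarrow> ('k, 'm) module, int \<Rightarrow> 'm \<Rightarrow> 'm) gr_fun" where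
  "gr_hom_fun C X = \<lparr>gfObj = (\<lambda>Y. gHom C X Y),
     gfMap = (\<lambda>Y Z n g d. \<lambda>h\<in>carrier (gHom C X Y d). gComp C X Y Z d n h g)\<rparr>"

text \<open>
  The functor \<open>gr(-,\<bbbk>) : gr\<^sup>o\<^sup>p \<rightarrow> gr\<close>; a morphism \<open>M \<rightarrow> N\<close> of degree \<open>n\<close> in
  \<open>gr\<^sup>o\<^sup>p\<close> is an \<open>f \<in> gr(N,M)\<^sup>n\<close>, and it acts by \<open>p \<mapsto> (-1)\<^sup>d\<^sup>n fp\<close> on
  \<open>p \<in> gr(M,\<bbbk>)\<^sup>d\<close>.
\<close>

definition gr_dual :: "('k, 'r) ring_scheme \<Rightarrow>
    (int \<Rightarrow> ('k, 'm) module, int \<Rightarrow> 'm \<Rightarrow> 'm, int \<Rightarrow> ('k, int \<Rightarrow> 'm \<Rightarrow> 'k) module,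
     int \<Rightarrow> (int \<Rightarrow> 'm \<Rightarrow> 'k) \<Rightarrow> (int \<Rightarrow> 'm \<Rightarrow> 'k)) gr_fun" where
  "gr_dual R = \<lparr>gfObj = (\<lambda>M. gr_hom R M (gr_unit R)),
     gfMap = (\<lambda>M N n f d. \<lambda>p\<in>carrier (gr_hom R M (gr_unit R) d).
       koszul (gr_hom R N (gr_unit R) (d + n)) d n (gr_comp N n f p))\<rparr>"

text \<open>A natural family has degree 0, so it contributes no sign.\<close>

definition gr_natural :: "('k, 'r) ring_scheme \<Rightarrow> ('o, 'm, 'k) gr_cat \<Rightarrow>
    ('o, 'm, int \<Rightarrow> ('k, 'a) module, int \<Rightarrow> 'a \<Rightarrow> 'a) gr_fun \<Rightarrow>
    ('o, 'm, int \<Rightarrow> ('k, 'b) module, int \<Rightarrow> 'b \<Rightarrow> 'b) gr_fun \<Rightarrow>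
    ('o \<Rightarrow> int \<Rightarrow> 'a \<Rightarrow> 'b) \<Rightarrow> bool" where
  "gr_natural R C F G \<psi> \<longleftrightarrow>
     (\<forall>X\<in>gObj C. \<psi> X \<in> carrier (gr_hom R (gfObj F X) (gfObj G X) 0)) \<and>
     (\<forall>X\<in>gObj C. \<forall>Y\<in>gObj C. \<forall>n. \<forall>f\<in>carrier (gHom C X Y n).
        gr_comp (gfObj F X) n (gfMap F X Y n f) (\<psi> Y) =
        gr_comp (gfObj F X) 0 (\<psi> X) (gfMap G X Y n f))"

definition right_Serre_gr_functor ::
  "('k, 'r) ring_scheme \<Rightarrow> ('o, 'm, 'k) gr_cat \<Rightarrow> ('o, 'm, 'o, 'm) gr_fun \<Rightarrow> bool" where
  "right_Serre_gr_functor R C S \<longleftrightarrow>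
     gr_functor R C C S \<and>
     (\<exists>\<psi>.
        (\<forall>X\<in>gObj C. \<forall>Y\<in>gObj C.
           gr_iso R (gHom C X (gfObj S Y)) (gr_hom R (gHom C Y X) (gr_unit R)) (\<psi> X Y)) \<and>
        (\<forall>Y\<in>gObj C.
           gr_natural R (gr_op C)
             (gr_hom_fun (gr_op C) (gfObj S Y))
             (gr_fun_comp (gr_fun_op (gr_hom_fun C Y)) (gr_dual R))
             (\<lambda>X. \<psi> X Y)) \<and>
        (\<forall>X\<in>gObj C.
           gr_natural R C
             (gr_fun_comp S (gr_hom_fun C X))
             (gr_fun_comp (gr_fun_op (gr_hom_fun (gr_op C) X)) (gr_dual R))
             (\<lambda>Y. \<psi> X Y)))"


section \<open>Base change along the degree-zero functor\<close>

definition N_cat :: "('o, 'm, 'k) gr_cat \<Rightarrow> ('o, 'm, 'k) lin_cat" where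
  "N_cat C = \<lparr>lObj = gObj C, lHom = (\<lambda>X Y. gHom C X Y 0),
     lComp = (\<lambda>X Y Z. gComp C X Y Z 0 0), lId = gId C\<rparr>"

definition N_fun :: "('o, 'm, 'p, 'n) gr_fun \<Rightarrow> ('o, 'm, 'p, 'n) lin_fun" where
  "N_fun F = \<lparr>lfObj = gfObj F, lfMap = (\<lambda>X Y. gfMap F X Y 0)\<rparr>"

end

theory Submission
  imports Defs
begin

text \<open>
  Since \<open>\<bbbk>\<close> is concentrated in degree 0, evaluation at \<open>d = 0\<close> identifies
  \<open>gr(M,\<bbbk>)\<^sup>0\<close> with \<open>Hom(M\<^sup>0,\<bbbk>)\<close>.  Composing the degree-zero part of \<open>\<psi>\<close> with this
  identification gives the required isomorphisms; they are natural because all Koszul signs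
  are trivial in degree 0.
\<close>

lemma koszul_0 [simp]: "koszul M 0 n x = x" "koszul M m 0 x = x"
  by (simp_all add: koszul_def)

text \<open>For \<open>F\<close> with values in graded modules, \<open>N_fun F\<close> still takes
  such values. This is its composite with the functor to modules given by degree-zero parts.\<close>

definition N_gr_fun :: "('o, 'm, int \<Rightarrow> ('k, 'a) module, int \<Rightarrow> 'a \<Rightarrow> 'a) gr_fun \<Rightarrow>
    ('o, 'm, ('k, 'a) module, 'a \<Rightarrow> 'a) lin_fun" where
  "N_gr_fun F = \<lparr>lfObj = (\<lambda>X. gfObj F X 0), lfMap = (\<lambda>X Y f. gfMap F X Y 0 f 0)\<rparr>"

lemma N_gr_fun_hom_fun: "N_gr_fun (gr_hom_fun C X) = lin_hom_fun (N_cat C) X"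
  by (simp add: N_gr_fun_def gr_hom_fun_def lin_hom_fun_def N_cat_def)

lemma N_gr_fun_comp: "N_gr_fun (gr_fun_comp F G) = lin_fun_comp (N_fun F) (N_gr_fun G)"
  by (simp add: N_gr_fun_def gr_fun_comp_def lin_fun_comp_def N_fun_def)

text \<open>The opposite composition carries its Koszul sign at m = n = 0, where
  \<open>koszul_0\<close> removes it.\<close>

lemma N_cat_op: "N_cat (gr_op C) = lin_op (N_cat C)"
  by (simp add: N_cat_def gr_op_def lin_op_def)

lemma N_cat_lin_category:
  assumes "gr_category R C"
  shows "lin_category R (N_cat C)"
proof -
  interpret gr_category R C by fact
  show ?thesis
    \<comment> \<open>Composition lands in degree m + n, so the instances at 0 are simplified to
      turn 0 + 0 into 0.\<close>
    by (intro lin_category.intro lin_category_axioms.intro is_cring;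
        unfold N_cat_def lin_cat.simps;
        (rule hom_module comp_closed[where m = 0 and n = 0, simplified]
          comp_add_left[where m = 0 and n = 0, simplified]
          comp_add_right[where m = 0 and n = 0, simplified]
          comp_smult_left[where m = 0 and n = 0, simplified]
          comp_smult_right[where m = 0 and n = 0, simplified] id_closed
          comp_id_left comp_id_right comp_assoc[where l = 0 and m = 0 and n = 0, simplified]))
qed

lemma N_fun_lin_functor:
  assumes "gr_functor R C D F"
  shows "lin_functor R (N_cat C) (N_cat D) (N_fun F)"
proof -
  interpret gr_functor R C D F by fact
  interpret NC: lin_category R "N_cat C"
    by (rule N_cat_lin_category) (rule source.gr_category_axioms)
  interpret ND: lin_category R "N_cat D"
    by (rule N_cat_lin_category) (rule target.gr_category_axioms)
  show ?thesis
    using obj_closed map_closed[where n = 0] map_add[where n = 0] map_smult[where n = 0]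
      map_id map_comp[where m = 0 and n = 0]
    by unfold_locales (simp_all add: N_cat_def N_fun_def)
qed

lemma gr_unit_module:
  assumes "cring R"
  shows "module R (gr_unit R n)"
proof -
  interpret cring R by fact
  have "module R (unit_mod R)"
    by (intro module.intro abelian_groupI module_axioms.intro is_cring)
      (auto simp: unit_mod_def a_ac l_distr r_distr m_assoc intro: add.l_inv_ex)
  moreover have "module R (zero_mod R)"
    by (intro module.intro abelian_groupI module_axioms.intro is_cring) (auto simp: zero_mod_def)
  ultimately show ?thesis by (simp add: gr_unit_def)
qed

lemma lin_hom_add_closed:
  assumes "module R M" and "module R N"
    and "f \<in> carrier (lin_hom R M N)" and "g \<in> carrier (lin_hom R M N)"
  shows "f \<oplus>\<^bsub>lin_hom R M N\<^esub> g \<in> carrier (lin_hom R M N)"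
proof -
  interpret M: module R M by fact
  interpret N: module R N by fact
  show ?thesis
    using assms(3,4) by (auto simp: lin_hom_def PiE_iff N.a_ac N.smult_r_distr)
qed

text \<open>Commutativity of the ring enters here: a multiple of \<open>f\<close> by r respects a
  scalar s because rs = sr.\<close>

lemma lin_hom_smult_closed:
  assumes "module R M" and "module R N" and "r \<in> carrier R" and "f \<in> carrier (lin_hom R M N)"
  shows "r \<odot>\<^bsub>lin_hom R M N\<^esub> f \<in> carrier (lin_hom R M N)"
proof -
  interpret M: module R M by fact
  interpret N: module R N by fact
  show ?thesis
    using assms(3,4)
    by (auto simp: lin_hom_def PiE_iff N.smult_r_distr M.m_comm simp flip: N.smult_assoc1)
qed

text \<open>For nonzero d the component \<open>p d\<close> lands in the zero module, so
  \<open>p 0\<close> determines \<open>p\<close>. Conversely, a linear form on \<open>M 0\<close>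
  extends by zero maps.\<close>

lemma gr_dual_eval_iso:
  assumes "cring R" and M: "\<And>d. module R (M d)"
  shows "lin_iso R (gr_hom R M (gr_unit R) 0) (lin_hom R (M 0) (unit_mod R))
    (\<lambda>p\<in>carrier (gr_hom R M (gr_unit R) 0). p 0)"
proof -
  interpret cring R by fact
  let ?G = "gr_hom R M (gr_unit R) 0" and ?H = "lin_hom R (M 0) (unit_mod R)"
  let ?z = "\<lambda>d. \<lambda>x\<in>carrier (M d). \<zero>\<^bsub>R\<^esub>"
  \<comment> \<open>The restricted evaluation is given by its formula only on the carrier, so its
    linearity requires sums and multiples to stay there.\<close>
  have add: "p \<oplus>\<^bsub>?G\<^esub> q \<in> carrier ?G" if "p \<in> carrier ?G" "q \<in> carrier ?G" for p q
    using that lin_hom_add_closed[OF M gr_unit_module[OF assms(1)]] by (simp add: gr_hom_def)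
  have smult: "r \<odot>\<^bsub>?G\<^esub> p \<in> carrier ?G" if "r \<in> carrier R" "p \<in> carrier ?G" for r p
    using that lin_hom_smult_closed[OF M gr_unit_module[OF assms(1)]] by (simp add: gr_hom_def)
  have eval_closed: "p 0 \<in> carrier ?H" if "p \<in> carrier ?G" for p
    using that[unfolded gr_hom_def, simplified, THEN spec, of 0] by (simp add: gr_unit_def)
  have eval: "(\<lambda>p\<in>carrier ?G. p 0) \<in> carrier (lin_hom R ?G ?H)"
  proof -
    have "(p \<oplus>\<^bsub>?G\<^esub> q) 0 = p 0 \<oplus>\<^bsub>?H\<^esub> q 0" "(r \<odot>\<^bsub>?G\<^esub> p) 0 = r \<odot>\<^bsub>?H\<^esub> p 0" for p q r
      by (simp_all add: gr_hom_def gr_unit_def)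
    \<comment> \<open>Only the outer hom is unfolded; the operations of \<open>?H\<close> stay
      folded to match the equations just shown.\<close>
    then show ?thesis
      using add smult eval_closed unfolding lin_hom_def[of R ?G] by simp
  qed
  have zero: "p d = ?z d" if "p \<in> carrier ?G" "d \<noteq> 0" for p d
    using that by (fastforce simp: gr_hom_def gr_unit_def lin_hom_def zero_mod_def PiE_iff
        extensional_def)
  have "inj_on (\<lambda>p\<in>carrier ?G. p 0) (carrier ?G)"
  proof (rule inj_onI)
    fix p q
    assume pq: "p \<in> carrier ?G" "q \<in> carrier ?G"
      and "(\<lambda>p\<in>carrier ?G. p 0) p = (\<lambda>p\<in>carrier ?G. p 0) q"
    then have "p 0 = q 0" by simp
    then show "p = q"
      using zero[OF pq(1)] zero[OF pq(2)] by (intro ext) metis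
  qed
  moreover have "q \<in> (\<lambda>p\<in>carrier ?G. p 0) ` carrier ?G" if "q \<in> carrier ?H" for q
  proof -
    have "?z d \<in> carrier (lin_hom R (M d) (zero_mod R))" for d
    proof -
      \<comment> \<open>Linearity of the restricted zero map is tested at sums and multiples, which
        must lie in the carrier of \<open>M d\<close>.\<close>
      interpret Md: module R "M d" by (rule M)
      show ?thesis by (auto simp: lin_hom_def zero_mod_def)
    qed
    then have "(\<lambda>d. if d = 0 then q else ?z d) \<in> carrier ?G"
      using that by (simp add: gr_hom_def gr_unit_def)
    then show ?thesis by (force intro: rev_image_eqI)
  qed
  moreover have "(\<lambda>p\<in>carrier ?G. p 0) ` carrier ?G \<subseteq> carrier ?H"
    using eval_closed by auto
  ultimately show ?thesis
    using eval unfolding lin_iso_def bij_betw_def by blast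
qed

text \<open>The closure hypotheses are there because \<open>lin_comp\<close> is restricted to the
  carrier of \<open>M\<close>.\<close>

lemma lin_iso_comp:
  assumes "lin_iso R M N f" and "lin_iso R N P g"
    and "\<And>x y. \<lbrakk>x \<in> carrier M; y \<in> carrier M\<rbrakk> \<Longrightarrow> x \<oplus>\<^bsub>M\<^esub> y \<in> carrier M"
    and "\<And>r x. \<lbrakk>r \<in> carrier R; x \<in> carrier M\<rbrakk> \<Longrightarrow> r \<odot>\<^bsub>M\<^esub> x \<in> carrier M"
  shows "lin_iso R M P (lin_comp M f g)"
proof -
  have "bij_betw (g \<circ> f) (carrier M) (carrier P)"
    using assms(1,2) by (auto simp: lin_iso_def intro: bij_betw_trans)
  then have "bij_betw (lin_comp M f g) (carrier M) (carrier P)"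
    by (rule bij_betw_cong[THEN iffD1, rotated]) (simp add: lin_comp_def)
  moreover have "lin_comp M f g \<in> carrier (lin_hom R M P)"
    using assms by (auto simp: lin_iso_def lin_hom_def lin_comp_def PiE_iff)
  ultimately show ?thesis by (simp add: lin_iso_def)
qed

text \<open>The degree-zero part of a map from \<open>A\<close> to the graded dual of
  \<open>M\<close>, followed by the comparison of \<open>gr_dual_eval_iso\<close>. Applied to the
  given family it yields the linear Serre isomorphisms.\<close>

definition N_dual :: "('k, 'r) ring_scheme \<Rightarrow> (int \<Rightarrow> ('k, 'a) module) \<Rightarrow> (int \<Rightarrow> ('k, 'm) module) \<Rightarrow>
    (int \<Rightarrow> 'a \<Rightarrow> int \<Rightarrow> 'm \<Rightarrow> 'k) \<Rightarrow> 'a \<Rightarrow> 'm \<Rightarrow> 'k" where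
  "N_dual R A M \<psi> = lin_comp (A 0) (\<psi> 0) (\<lambda>p\<in>carrier (gr_hom R M (gr_unit R) 0). p 0)"

lemma N_dual_iso:
  assumes "cring R" and "module R (A 0)" and "\<And>d. module R (M d)"
    and "gr_iso R A (gr_hom R M (gr_unit R)) \<psi>"
  shows "lin_iso R (A 0) (lin_hom R (M 0) (unit_mod R)) (N_dual R A M \<psi>)"
proof -
  interpret A: module R "A 0" by fact
  \<comment> \<open>Only the outer \<open>gr_hom\<close> is unfolded, since the target is itself a
    \<open>gr_hom\<close>, taken in degree 0 + 0.\<close>
  have "\<psi> 0 \<in> carrier (lin_hom R (A 0) (gr_hom R M (gr_unit R) (0 + 0)))"
    using assms(4) unfolding gr_iso_def gr_hom_def[of R A] by simp
  then have "lin_iso R (A 0) (gr_hom R M (gr_unit R) 0) (\<psi> 0)"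
    using assms(4) by (simp add: gr_iso_def lin_iso_def)
  then show ?thesis
    unfolding N_dual_def by (rule lin_iso_comp) (auto intro: gr_dual_eval_iso assms)
qed

text \<open>Graded naturality is read off at a morphism of degree 0 and at component 0, and the
  resulting families are then evaluated at 0. With \<open>F\<close> and \<open>G\<close> general,
  this serves both variables of the Serre isomorphism.\<close>

lemma N_dual_natural:
  assumes nat: "gr_natural R C F (gr_fun_comp (gr_fun_op G) (gr_dual R)) \<psi>"
    and iso: "\<And>X. X \<in> gObj C \<Longrightarrow> lin_iso R (gfObj F X 0)
        (lin_hom R (gfObj G X 0) (unit_mod R)) (N_dual R (gfObj F X) (gfObj G X) (\<psi> X))"
    and F: "\<And>X Y f h. \<lbrakk>X \<in> gObj C; Y \<in> gObj C; f \<in> carrier (gHom C X Y 0);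
        h \<in> carrier (gfObj F X 0)\<rbrakk> \<Longrightarrow> gfMap F X Y 0 f 0 h \<in> carrier (gfObj F Y 0)"
  shows "lin_natural R (N_cat C) (N_gr_fun F)
      (lin_fun_comp (lin_fun_op (N_gr_fun G)) (lin_dual R))
      (\<lambda>X. N_dual R (gfObj F X) (gfObj G X) (\<psi> X))"
    (is "lin_natural _ _ _ ?H _")
proof -
  let ?D = "\<lambda>X. gr_hom R (gfObj G X) (gr_unit R) 0"
  let ?N = "\<lambda>X. N_dual R (gfObj F X) (gfObj G X) (\<psi> X)"
  have \<psi>: "\<psi> X 0 h \<in> carrier (?D X)" if "X \<in> gObj C" "h \<in> carrier (gfObj F X 0)" for X h
  proof -
    have "\<psi> X \<in> carrier (gr_hom R (gfObj F X) (gr_hom R (gfObj G X) (gr_unit R)) 0)"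
      using nat that(1)
      by (simp add: gr_natural_def gr_fun_comp_def gr_fun_op_def gr_dual_def)
    then have "\<psi> X 0 \<in> carrier (lin_hom R (gfObj F X 0) (gr_hom R (gfObj G X) (gr_unit R) (0 + 0)))"
      unfolding gr_hom_def[of R "gfObj F X"] by simp
    then show ?thesis
      using that(2) by (auto simp: lin_hom_def)
  qed
  have 1: "?N X \<in> carrier (lin_hom R (lfObj (N_gr_fun F) X) (lfObj ?H X))"
    if "X \<in> gObj C" for X
    using iso[OF that]
    by (simp add: lin_iso_def N_gr_fun_def lin_fun_comp_def lin_fun_op_def lin_dual_def)
  have N: "?N X h = \<psi> X 0 h 0" if "X \<in> gObj C" "h \<in> carrier (gfObj F X 0)" for X h
    using that \<psi> by (simp add: N_dual_def lin_comp_def)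
  have 2: "?N Y (gfMap F X Y 0 f 0 h) = lfMap ?H X Y f (?N X h)"
    if X: "X \<in> gObj C" and Y: "Y \<in> gObj C" and f: "f \<in> carrier (gHom C X Y 0)"
      and h: "h \<in> carrier (gfObj F X 0)" for X Y f h
  proof -
    have "gr_comp (gfObj F X) 0 (gfMap F X Y 0 f) (\<psi> Y) 0 h =
        gr_comp (gfObj F X) 0 (\<psi> X) (gfMap (gr_fun_comp (gr_fun_op G) (gr_dual R)) X Y 0 f) 0 h"
      using nat X Y f by (simp add: gr_natural_def)
    \<comment> \<open>The sign in \<open>gr_dual\<close> has d = n = 0 and vanishes. Only the
      composites out of \<open>gfObj F X\<close> are unfolded; the one produced by
      \<open>gr_dual\<close> remains.\<close>
    then have "\<psi> Y 0 (gfMap F X Y 0 f 0 h) = gr_comp (gfObj G Y) 0 (gfMap G Y X 0 f) (\<psi> X 0 h)"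
      using h \<psi>[OF X h]
      by (simp add: gr_comp_def[of "gfObj F X"] lin_comp_def gr_fun_comp_def gr_fun_op_def gr_dual_def)
    \<comment> \<open>The action of \<open>lin_dual\<close> is restricted to linear forms, so it can
      be computed at \<open>?N X h\<close> only once this is known to be one.\<close>
    moreover have "?N X h \<in> carrier (lin_hom R (gfObj G X 0) (unit_mod R))"
      using iso[OF X] h by (auto simp: lin_iso_def bij_betw_def)
    ultimately show ?thesis
      using X Y h F[OF X Y f h] N
      by (simp add: gr_comp_def lin_fun_comp_def lin_fun_op_def lin_dual_def N_gr_fun_def)
  qed
  show ?thesis
    using 1 2
    by (auto simp: lin_natural_def N_cat_def lin_comp_def N_gr_fun_def intro!: restrict_ext)
qed

theorem corollary2p18:
  fixes R :: "('k, 'r) ring_scheme"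
    and C :: "('o, 'm, 'k) gr_cat"
    and S :: "('o, 'm, 'o, 'm) gr_fun"
  assumes "cring R"
    and "gr_category R C"
    and "right_Serre_gr_functor R C S"
  shows "right_Serre_lin_functor R (N_cat C) (N_fun S)"
proof -
  from assms(3) obtain \<psi> where S: "gr_functor R C C S"
    and iso: "\<And>X Y. \<lbrakk>X \<in> gObj C; Y \<in> gObj C\<rbrakk> \<Longrightarrow>
        gr_iso R (gHom C X (gfObj S Y)) (gr_hom R (gHom C Y X) (gr_unit R)) (\<psi> X Y)"
    and natX: "\<And>Y. Y \<in> gObj C \<Longrightarrow> gr_natural R (gr_op C) (gr_hom_fun (gr_op C) (gfObj S Y))
        (gr_fun_comp (gr_fun_op (gr_hom_fun C Y)) (gr_dual R)) (\<lambda>X. \<psi> X Y)"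
    and natY: "\<And>X. X \<in> gObj C \<Longrightarrow> gr_natural R C (gr_fun_comp S (gr_hom_fun C X))
        (gr_fun_comp (gr_fun_op (gr_hom_fun (gr_op C) X)) (gr_dual R)) (\<lambda>Y. \<psi> X Y)"
    unfolding right_Serre_gr_functor_def by blast
  interpret S: gr_functor R C C S by fact
  let ?\<phi> = "\<lambda>X Y. N_dual R (gHom C X (gfObj S Y)) (gHom C Y X) (\<psi> X Y)"
  have comp: "gComp C X Y Z 0 0 f g \<in> carrier (gHom C X Z 0)"
    if "X \<in> gObj C" "Y \<in> gObj C" "Z \<in> gObj C"
      "f \<in> carrier (gHom C X Y 0)" "g \<in> carrier (gHom C Y Z 0)" for X Y Z f g
    using S.source.comp_closed[OF that] by simp
  have iso': "lin_iso R (gHom C X (gfObj S Y) 0) (lin_hom R (gHom C Y X 0) (unit_mod R)) (?\<phi> X Y)"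
    if "X \<in> gObj C" "Y \<in> gObj C" for X Y
    using that by (intro N_dual_iso iso assms(1) S.source.hom_module S.obj_closed)
  have natX': "lin_natural R (lin_op (N_cat C)) (lin_hom_fun (lin_op (N_cat C)) (gfObj S Y))
      (lin_fun_comp (lin_fun_op (lin_hom_fun (N_cat C) Y)) (lin_dual R)) (\<lambda>X. ?\<phi> X Y)"
    if Y: "Y \<in> gObj C" for Y
    \<comment> \<open>The first call recognises base-changed hom functors as linear ones while they
      are folded; the second unfolds them so that \<open>iso'\<close> and \<open>comp\<close>
      discharge the premises.\<close>
    using N_dual_natural[OF natX[OF Y]] iso' Y comp S.obj_closed
    by (simp add: N_gr_fun_hom_fun N_cat_op) (simp add: gr_hom_fun_def gr_op_def)
  have natY': "lin_natural R (N_cat C) (lin_fun_comp (N_fun S) (lin_hom_fun (N_cat C) X))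
      (lin_fun_comp (lin_fun_op (lin_hom_fun (lin_op (N_cat C)) X)) (lin_dual R)) (\<lambda>Y. ?\<phi> X Y)"
    if X: "X \<in> gObj C" for X
    \<comment> \<open>The source functor is now \<open>S\<close> followed by a hom functor:
      \<open>N_gr_fun_comp\<close> splits its base change, and \<open>S.map_closed\<close> keeps the
      image of a morphism in degree 0.\<close>
    using N_dual_natural[OF natY[OF X]] iso' X comp S.obj_closed S.map_closed
    by (simp add: N_gr_fun_hom_fun N_gr_fun_comp N_cat_op)
      (simp add: gr_hom_fun_def gr_op_def gr_fun_comp_def)
  show ?thesis
    unfolding right_Serre_lin_functor_def
  proof (intro conjI exI ballI)
    show "lin_functor R (N_cat C) (N_cat C) (N_fun S)"
      by (rule N_fun_lin_functor) fact
  qed (use iso' natX' natY' in \<open>simp_all add: N_cat_def[of C] N_fun_def\<close>)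
qed

end
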